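(* There exists an unrestricted trapezoid $T\subset\mathbb{R}^2$ with $\mu_1(T_0)=\mu_1(T_1)=\infty$ and $\mu_2(T)=0$.
   Context: Let $X_0=\{(x,y)\in\mathbb{R}^2:y=0\}$ and $X_1=\{(x,y)\in\mathbb{R}^2:y=1\}$. An unrestricted trapezoid $T=\bigcup\ell$ is a union (not necessarily disjoint) of line segments, each segment having its two endpoints on $X_0$ and $X_1$, i.e. each $\ell$ has the form $\ell=\{((1-t)x_0+tx_1,t):t\in[0,1]\}$ for some $x_0,x_1\in\mathbb{R}$. For an unrestricted trapezoid $T$, write $T_0=T\cap X_0$ and $T_1=T\cap X_1$. Here $\mu_1$ is one-dimensional Lebesgue measure (on the lines $X_0$, $X_1$, each identified with $\mathbb{R}$ via the $x$-coordinate) and $\mu_2$ is two-dimensional Lebesgue measure on $\mathbb{R}^2$. *)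

theory Defs
  imports "HOL-Analysis.Analysis"
begin

definition X0 :: "(real \<times> real) set" where
  "X0 = {(x, y). y = 0}"

definition X1 :: "(real \<times> real) set" where
  "X1 = {(x, y). y = 1}"

definition unrestricted_trapezoid :: "(real \<times> real) set \<Rightarrow> bool" where
  "unrestricted_trapezoid T \<longleftrightarrow>
     (\<exists>L. (\<forall>l\<in>L. \<exists>p\<in>X0. \<exists>q\<in>X1. l = closed_segment p q) \<and> T = \<Union>L)"

lemma closed_segment_X0_X1:
  "closed_segment (x0, 0) (x1, 1) = {((1 - t) * x0 + t * x1, t) | t::real. t \<in> {0..1}}"
  by (auto simp: closed_segment_def)

text \<open>A horizontal line is identified with the reals through the x-coordinate, so the
  one-dimensional measure of a subset of it is the Lebesgue measure of its first projection.\<close>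

definition line_coord :: "(real \<times> real) set \<Rightarrow> real set" where
  "line_coord A = fst ` A"

end

theory Submission
  imports Defs
begin

text \<open>
  Let \<open>C\<close> be the set of reals \<open>\<Sum>i\<ge>1. c\<^sub>i / 4 ^ i\<close> with all digits \<open>c\<^sub>i\<close> in \<open>{0, 1}\<close>. Join
  \<open>(a + 2 b, 0)\<close> to \<open>(2 a + b, 1)\<close> for all \<open>a, b \<in> C\<close>. As \<open>e + 2 f\<close> with \<open>e, f \<in> {0, 1}\<close> runs
  over all base-4 digits, the end points fill \<open>[0, 1]\<close> on both lines, and the integer translates of
  this compact piece meet both lines in every point. It remains to see that the piece is null.

  The piece meets the line at height \<open>t\<close> in \<open>K = \<alpha> C + \<beta> C\<close>, where \<open>\<alpha> = 1 + t\<close> and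
  \<open>\<beta> = 2 - t\<close>; by Fubini it suffices that \<open>K\<close> is null for almost every \<open>t \<in> [0, 1]\<close>.
  Self-similarity covers \<open>4 ^ n K\<close> by at most \<open>4 ^ n\<close> translates \<open>K + \<alpha> p + \<beta> q\<close>, where \<open>p\<close> and
  \<open>q\<close> are integers with \<open>n\<close> base-4 digits in \<open>{0, 1}\<close>. There is no measure to spare in this
  covering: if \<open>K\<close> has positive measure, then no two of these translates can overlap
  substantially, and so their displacements stay at least some \<open>\<epsilon> > 0\<close> apart, for all \<open>n\<close>
  (\<open>slice_positive_imp_separated\<close>).

  The heights \<open>t\<close> whose displacements are \<open>\<epsilon>\<close>-separated form a closed set. It is porous:
  around any \<open>t\<close> and for any \<open>n\<close>, two displacements can be found whose difference, an affine
  function of the height, is bounded by 1 at \<open>t\<close> and has slope comparable to \<open>4 ^ n\<close>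
  (\<open>steep_bounded_combination\<close>). It therefore vanishes within distance of order \<open>4 ^ -n\<close> of \<open>t\<close>, and
  it is below \<open>\<epsilon>\<close> on an interval of length of order \<open>\<epsilon> 4 ^ -n\<close> around that zero. A porous set
  is null (\<open>porous_imp_null\<close>), and a countable union over \<open>\<epsilon>\<close> finishes the proof.
\<close>

section \<open>Porous sets of reals are null\<close>

text \<open>Every interval has a proportion \<open>\<eta>\<close> of its length in a gap of \<open>N\<close>, so any estimate
  \<open>measure (N \<inter> {a..b}) \<le> \<theta> (b - a)\<close> that holds for all subintervals can be applied to the two parts
  left and right of the gap, which improves \<open>\<theta>\<close> to \<open>\<theta> (1 - \<eta>)\<close>. Iterating drives \<open>\<theta>\<close> to 0.\<close>
lemma porous_imp_null:
  fixes N :: "real set"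
  assumes meas: "N \<in> sets lborel" and "0 < \<eta>"
    and gap: "\<And>a b. l \<le> a \<Longrightarrow> a < b \<Longrightarrow> b \<le> u \<Longrightarrow>
      \<exists>c d. a \<le> c \<and> c \<le> d \<and> d \<le> b \<and> \<eta> * (b - a) \<le> d - c \<and> N \<inter> {c..d} = {}"
  shows "emeasure lborel (N \<inter> {l..u}) = 0"
proof (cases "l < u")
  case False
  then have "N \<inter> {l..u} \<subseteq> {l..l}" by auto
  then have "emeasure lborel (N \<inter> {l..u}) \<le> emeasure lborel {l..l}"
    by (rule emeasure_mono) simp
  then show ?thesis by simp
next
  case True
  have fm: "N \<inter> {a..b} \<in> fmeasurable lborel" for a b
    by (rule fmeasurable_Int_fmeasurable[OF _ meas, of "{a..b}", simplified Int_commute])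
       (simp add: fmeasurable_def emeasure_lborel_Icc_eq)
  obtain c d where "l \<le> c" "d \<le> u" "\<eta> * (u - l) \<le> d - c"
    using gap[of l u] True by auto
  moreover from this have "d - c \<le> u - l" by linarith
  ultimately have "\<eta> * (u - l) \<le> 1 * (u - l)" by simp
  then have \<eta>1: "\<eta> \<le> 1" using True by (simp add: mult_le_cancel_right)
  have bound: "measure lborel (N \<inter> {a..b}) \<le> (1 - \<eta>) ^ k * (b - a)"
    if "l \<le> a" "a \<le> b" "b \<le> u" for a b k
    using that
  proof (induction k arbitrary: a b)
    case 0
    have "measure lborel (N \<inter> {a..b}) \<le> measure lborel {a..b}"
      by (rule measure_mono_fmeasurable) (use meas in \<open>auto simp: fmeasurable_def emeasure_lborel_Icc_eq\<close>)
    then show ?case using 0 by simp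
  next
    case (Suc k)
    show ?case
    proof (cases "a < b")
      case False
      then have "a = b" using Suc.prems by simp
      have "measure lborel (N \<inter> {a..b}) \<le> measure lborel {a..b}"
        by (rule measure_mono_fmeasurable) (use meas in \<open>auto simp: fmeasurable_def emeasure_lborel_Icc_eq\<close>)
      then show ?thesis using \<open>a = b\<close> by simp
    next
      case True
      obtain c d where cd: "a \<le> c" "c \<le> d" "d \<le> b" "\<eta> * (b - a) \<le> d - c" "N \<inter> {c..d} = {}"
        using gap[of a b] True Suc.prems by auto
      have "N \<inter> {a..b} \<subseteq> (N \<inter> {a..c}) \<union> (N \<inter> {d..b})"
      proof
        fix x assume x: "x \<in> N \<inter> {a..b}"
        then have "x \<notin> {c..d}" using cd by blast
        then show "x \<in> (N \<inter> {a..c}) \<union> (N \<inter> {d..b})" using x by auto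
      qed
      then have "measure lborel (N \<inter> {a..b}) \<le> measure lborel ((N \<inter> {a..c}) \<union> (N \<inter> {d..b}))"
        by (rule measure_mono_fmeasurable) (use fm meas in auto)
      also have "\<dots> \<le> measure lborel (N \<inter> {a..c}) + measure lborel (N \<inter> {d..b})"
        by (rule measure_Un_le) (use meas in auto)
      also have "\<dots> \<le> (1 - \<eta>) ^ k * (c - a) + (1 - \<eta>) ^ k * (b - d)"
        using Suc.IH[of a c] Suc.IH[of d b] Suc.prems cd by (intro add_mono) auto
      also have "\<dots> = (1 - \<eta>) ^ k * ((b - a) - (d - c))"
        by (simp add: algebra_simps)
      also have "\<dots> \<le> (1 - \<eta>) ^ k * ((1 - \<eta>) * (b - a))"
        using cd \<eta>1 by (intro mult_left_mono) (auto simp: algebra_simps)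
      finally show ?thesis by (simp add: mult_ac)
    qed
  qed
  have "(\<lambda>k. (1 - \<eta>) ^ k * (u - l)) \<longlonglongrightarrow> 0 * (u - l)"
    by (intro tendsto_mult LIMSEQ_power_zero tendsto_const) (use \<eta>1 \<open>0 < \<eta>\<close> in auto)
  then have "measure lborel (N \<inter> {l..u}) \<le> 0 * (u - l)"
    by (rule LIMSEQ_le_const) (intro exI[of _ 0] allI impI bound, use True in auto)
  then have "measure lborel (N \<inter> {l..u}) = 0"
    using measure_nonneg[of lborel "N \<inter> {l..u}"] by linarith
  then show ?thesis
    using emeasure_eq_measure2[OF fm[of l u]] by simp
qed

section \<open>The Cantor set of base-4 digits 0 and 1\<close>

text \<open>The starting interval is \<open>[0, 1/3]\<close> because \<open>1/3\<close> is the number all of whose digits are 1. The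
  intersection of the stages is the set \<open>C\<close> of the introduction; it is defined without series, so
  that its properties follow from those of the stages by compactness.\<close>

primrec cantor_stage :: "nat \<Rightarrow> real set" where
  "cantor_stage 0 = {0..1/3}"
| "cantor_stage (Suc n) = (\<lambda>x. x / 4) ` cantor_stage n \<union> (\<lambda>x. (x + 1) / 4) ` cantor_stage n"

definition cantor4 :: "real set" where
  "cantor4 = (\<Inter>n. cantor_stage n)"

lemma compact_cantor_stage: "compact (cantor_stage n)"
  by (induction n) (auto intro!: compact_Un compact_continuous_image continuous_intros)

lemma cantor_stage_Suc_subset: "cantor_stage (Suc n) \<subseteq> cantor_stage n"
proof (induction n)
  case (Suc n)
  then show ?case by (subst (1 2) cantor_stage.simps(2)) blast
qed auto

lemma cantor_stage_antimono: "m \<le> n \<Longrightarrow> cantor_stage n \<subseteq> cantor_stage m"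
  by (rule lift_Suc_antimono_le[of cantor_stage, OF cantor_stage_Suc_subset])

lemma compact_cantor4: "compact cantor4"
  unfolding cantor4_def by (rule compact_Inter) (auto simp: compact_cantor_stage)

text \<open>Removing the leading digit. The digit could depend on the stage, but a digit that fails
  at some stage fails at all later ones because the stages decrease.\<close>

lemma cantor4_shift:
  assumes "x \<in> cantor4"
  shows "\<exists>e\<in>{0,1}. 4 * x - e \<in> cantor4"
proof (rule ccontr)
  assume "\<not> ?thesis"
  then obtain m n where "4 * x \<notin> cantor_stage m" "4 * x - 1 \<notin> cantor_stage n"
    unfolding cantor4_def by auto
  then have "4 * x \<notin> cantor_stage (max m n)" "4 * x - 1 \<notin> cantor_stage (max m n)"
    using cantor_stage_antimono[of m "max m n"] cantor_stage_antimono[of n "max m n"] by auto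
  moreover have "x \<in> cantor_stage (Suc (max m n))"
    using assms unfolding cantor4_def by blast
  ultimately show False by (auto simp: field_simps)
qed

text \<open>The numbers \<open>e + 2 f\<close> with \<open>e, f \<in> {0, 1}\<close> are exactly the base-4 digits, so the leading
  digit of \<open>x\<close> prescribes the leading digits of \<open>a\<close> and \<open>b\<close>.\<close>

lemma unit_interval_cantor_stage:
  assumes "0 \<le> x" "x \<le> 1"
  shows "\<exists>a\<in>cantor_stage n. \<exists>b\<in>cantor_stage n. x = a + 2 * b"
  using assms
proof (induction n arbitrary: x)
  case 0
  then show ?case by (intro bexI[of _ "x / 3"]) auto
next
  case (Suc n)
  define y where "y = 4 * x"
  have "\<exists>e\<in>{0,1}. \<exists>f\<in>{0,1}. 0 \<le> y - (e + 2 * f) \<and> y - (e + 2 * f) \<le> 1"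
    using Suc.prems by (auto simp: y_def)
  then obtain e f :: real where ef: "e \<in> {0,1}" "f \<in> {0,1}"
    "0 \<le> y - (e + 2 * f)" "y - (e + 2 * f) \<le> 1" by blast
  obtain a b where ab: "a \<in> cantor_stage n" "b \<in> cantor_stage n" "y - (e + 2 * f) = a + 2 * b"
    using Suc.IH[OF ef(3,4)] by auto
  have "(a + e) / 4 \<in> cantor_stage (Suc n)" "(b + f) / 4 \<in> cantor_stage (Suc n)"
    using ab ef by auto
  moreover have "x = (a + e) / 4 + 2 * ((b + f) / 4)"
    using ab(3) by (simp add: y_def field_simps)
  ultimately show ?case by blast
qed

lemma unit_interval_cantor4:
  assumes "0 \<le> x" "x \<le> 1"
  shows "\<exists>a\<in>cantor4. \<exists>b\<in>cantor4. x = a + 2 * b"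
proof -
  define P where "P n = (cantor_stage n \<times> cantor_stage n) \<inter> {p. x = fst p + 2 * snd p}" for n
  have "closed {p::real \<times> real. x = fst p + 2 * snd p}"
    by (intro closed_Collect_eq continuous_intros)
  then have "\<And>n. compact (P n)"
    unfolding P_def by (intro compact_Int_closed compact_Times compact_cantor_stage)
  moreover have "\<And>n. P n \<noteq> {}"
    using unit_interval_cantor_stage[OF assms] by (fastforce simp: P_def)
  moreover have "\<And>m n. m \<le> n \<Longrightarrow> P n \<subseteq> P m"
    using cantor_stage_antimono unfolding P_def by blast
  ultimately have "(\<Inter>n. P n) \<noteq> {}" by (rule compact_nest)
  then show ?thesis unfolding P_def cantor4_def by fastforce
qed

section \<open>A close pair of translates forces a null slice\<close>

text \<open>The integers with \<open>n\<close> base-4 digits in \<open>{0, 1}\<close>, as reals.\<close>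

primrec digit_sums :: "nat \<Rightarrow> real set" where
  "digit_sums 0 = {0}"
| "digit_sums (Suc n) = (\<lambda>x. 4 * x) ` digit_sums n \<union> (\<lambda>x. 4 * x + 1) ` digit_sums n"

lemma digit_sums_SucI: "x \<in> digit_sums n \<Longrightarrow> e \<in> {0,1} \<Longrightarrow> 4 * x + e \<in> digit_sums (Suc n)"
  by auto

lemma finite_digit_sums: "finite (digit_sums n)"
  by (induction n) auto

lemma card_digit_sums: "card (digit_sums n) \<le> 2 ^ n"
proof (induction n)
  case (Suc n)
  have "card (digit_sums (Suc n)) \<le>
      card ((\<lambda>x. 4 * x) ` digit_sums n) + card ((\<lambda>x. 4 * x + 1) ` digit_sums n)"
    by (simp add: card_Un_le)
  also have "\<dots> \<le> card (digit_sums n) + card (digit_sums n)"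
    by (intro add_mono card_image_le finite_digit_sums)
  finally show ?case using Suc by simp
qed simp

lemma cantor4_scaled:
  assumes "x \<in> cantor4"
  shows "\<exists>p\<in>digit_sums n. 4 ^ n * x - p \<in> cantor4"
proof (induction n)
  case 0
  then show ?case using assms by simp
next
  case (Suc n)
  then obtain p where p: "p \<in> digit_sums n" "4 ^ n * x - p \<in> cantor4" by blast
  obtain e where e: "e \<in> {0,1}" "4 * (4 ^ n * x - p) - e \<in> cantor4"
    using cantor4_shift[OF p(2)] by blast
  have "4 ^ Suc n * x - (4 * p + e) \<in> cantor4"
    using e(2) by (simp add: algebra_simps)
  then show ?case using digit_sums_SucI[OF p(1) e(1)] by blast
qed

text \<open>With \<open>\<alpha> = 1 + t\<close> and \<open>\<beta> = 2 - t\<close> this is the section at height \<open>t\<close> of the set of segments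
  constructed below.\<close>

definition slice :: "real \<Rightarrow> real \<Rightarrow> real set" where
  "slice \<alpha> \<beta> = (\<lambda>(a, b). \<alpha> * a + \<beta> * b) ` (cantor4 \<times> cantor4)"

lemma compact_slice: "compact (slice \<alpha> \<beta>)"
  unfolding slice_def
  by (intro compact_continuous_image compact_Times compact_cantor4)
     (auto intro!: continuous_intros simp: case_prod_beta)

text \<open>Self-similarity: \<open>p\<close> and \<open>q\<close> collect the first \<open>n\<close> digits of the two summands.\<close>

lemma slice_scaled:
  "(\<lambda>x. 4 ^ n * x) ` slice \<alpha> \<beta> \<subseteq>
    (\<Union>(p, q)\<in>digit_sums n \<times> digit_sums n. (+) (\<alpha> * p + \<beta> * q) ` slice \<alpha> \<beta>)"
proof
  fix y assume "y \<in> (\<lambda>x. 4 ^ n * x) ` slice \<alpha> \<beta>"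
  then obtain a b where ab: "a \<in> cantor4" "b \<in> cantor4" "y = 4 ^ n * (\<alpha> * a + \<beta> * b)"
    by (auto simp: slice_def)
  obtain p q where pq: "p \<in> digit_sums n" "q \<in> digit_sums n"
    "4 ^ n * a - p \<in> cantor4" "4 ^ n * b - q \<in> cantor4"
    using cantor4_scaled ab by meson
  have "\<alpha> * (4 ^ n * a - p) + \<beta> * (4 ^ n * b - q) \<in> slice \<alpha> \<beta>"
    using pq by (auto simp: slice_def)
  moreover have "y = (\<alpha> * p + \<beta> * q) + (\<alpha> * (4 ^ n * a - p) + \<beta> * (4 ^ n * b - q))"
    using ab by (simp add: algebra_simps)
  ultimately show "y \<in> (\<Union>(p, q)\<in>digit_sums n \<times> digit_sums n. (+) (\<alpha> * p + \<beta> * q) ` slice \<alpha> \<beta>)"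
    using pq(1,2) by blast
qed

text \<open>At no level do two translates in the covering of the scaled slice come \<open>\<epsilon>\<close>-close.\<close>

definition separated :: "real \<Rightarrow> real \<Rightarrow> real \<Rightarrow> bool" where
  "separated \<epsilon> \<alpha> \<beta> \<longleftrightarrow> (\<forall>n. \<forall>p\<in>digit_sums n. \<forall>q\<in>digit_sums n. \<forall>p'\<in>digit_sums n. \<forall>q'\<in>digit_sums n.
     (p, q) \<noteq> (p', q') \<longrightarrow> \<epsilon> \<le> \<bar>\<alpha> * (p - p') + \<beta> * (q - q')\<bar>)"

lemma separated_mono: "separated \<epsilon> \<alpha> \<beta> \<Longrightarrow> \<delta> \<le> \<epsilon> \<Longrightarrow> separated \<delta> \<alpha> \<beta>"
  unfolding separated_def by (meson order_trans)

text \<open>By outer regularity some open superset of \<open>K\<close> has measure below \<open>m\<close>, and by compactness it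
  contains all translates of \<open>K\<close> by less than some \<open>\<epsilon>\<close>.\<close>

lemma compact_measure_thickening:
  fixes K :: "real set"
  assumes "compact K" "measure lebesgue K < m"
  obtains \<epsilon> U where "0 < \<epsilon>" "U \<in> lmeasurable" "measure lebesgue U < m"
    "\<And>x y. x \<in> K \<Longrightarrow> \<bar>x - y\<bar> < \<epsilon> \<Longrightarrow> y \<in> U"
proof -
  have K: "K \<in> lmeasurable" using assms(1) by (rule lmeasurable_compact)
  obtain U where U: "open U" "K \<subseteq> U" "U - K \<in> lmeasurable"
      "emeasure lebesgue (U - K) < ennreal (m - measure lebesgue K)"
    using sets_lebesgue_outer_open[of K "m - measure lebesgue K"] K assms(2)
    by (auto simp: fmeasurableD)
  have "measure lebesgue (U - K) < m - measure lebesgue K"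
    using U(3,4) by (simp add: emeasure_eq_measure2 ennreal_less_iff)
  moreover have U_eq: "U = K \<union> (U - K)" using U(2) by blast
  moreover have "measure lebesgue (K \<union> (U - K)) \<le> measure lebesgue K + measure lebesgue (U - K)"
    using K U(3) by (intro measure_Un_le) (auto simp: fmeasurableD)
  ultimately have Um: "measure lebesgue U < m" by simp
  have "K \<union> (U - K) \<in> lmeasurable" using K U(3) by (rule fmeasurable.Un)
  then have "U \<in> lmeasurable" using U_eq by simp
  obtain \<epsilon> where "0 < \<epsilon>" "(\<Union>x\<in>K. ball x \<epsilon>) \<subseteq> U"
    using compact_subset_open_imp_ball_epsilon_subset[OF assms(1) U(1,2)] by auto
  then show ?thesis
    using Um \<open>U \<in> lmeasurable\<close> by (intro that[of \<epsilon> U]) (force simp: dist_real_def subset_iff)+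
qed

text \<open>If two of the translates covering \<open>4 ^ n K\<close> are close, then they lie in a common set of measure
  less than \<open>2 m\<close>, where \<open>m\<close> is the measure of \<open>K\<close>. The remaining at most \<open>4 ^ n - 2\<close> translates
  then leave the total below \<open>4 ^ n m\<close>, the measure of the scaled slice.\<close>

lemma slice_positive_imp_separated:
  assumes "measure lebesgue (slice \<alpha> \<beta>) \<noteq> 0"
  shows "\<exists>\<epsilon>>0. separated \<epsilon> \<alpha> \<beta>"
proof -
  define K where "K = slice \<alpha> \<beta>"
  define m where "m = measure lebesgue K"
  have "0 < m" using assms by (simp add: m_def K_def zero_less_measure_iff)
  have Km: "K \<in> lmeasurable"
    unfolding K_def by (rule lmeasurable_compact[OF compact_slice])
  obtain \<epsilon> U where eU: "0 < \<epsilon>" "U \<in> lmeasurable" "measure lebesgue U < 2 * m"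
    "\<And>x y. x \<in> K \<Longrightarrow> \<bar>x - y\<bar> < \<epsilon> \<Longrightarrow> y \<in> U"
    using compact_measure_thickening[of K "2 * m"] \<open>0 < m\<close> compact_slice
    by (auto simp: m_def K_def)
  have "separated \<epsilon> \<alpha> \<beta>"
    unfolding separated_def
  proof (intro allI ballI impI, rule ccontr)
    fix n p q p' q'
    assume pq: "p \<in> digit_sums n" "q \<in> digit_sums n" "p' \<in> digit_sums n" "q' \<in> digit_sums n"
      and ne: "(p, q) \<noteq> (p', q')"
      and "\<not> \<epsilon> \<le> \<bar>\<alpha> * (p - p') + \<beta> * (q - q')\<bar>"
    then have close: "\<bar>\<alpha> * (p - p') + \<beta> * (q - q')\<bar> < \<epsilon>" by simp
    define I where "I = digit_sums n \<times> digit_sums n"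
    define J where "J = I - {(p, q), (p', q')}"
    define S where "S = (\<lambda>(p, q). (+) (\<alpha> * p + \<beta> * q) ` K)"
    define V where "V = (+) (\<alpha> * p + \<beta> * q) ` U"
    have "finite I" by (simp add: I_def finite_digit_sums)
    have "card I \<le> 2 ^ n * 2 ^ n"
      unfolding I_def card_cartesian_product by (intro mult_mono card_digit_sums) auto
    then have cI: "card I \<le> 4 ^ n"
      by (simp add: power_mult_distrib[symmetric])
    have "card {(p, q), (p', q')} = 2" using ne by auto
    moreover have "{(p, q), (p', q')} \<subseteq> I" using pq by (auto simp: I_def)
    ultimately have cJ: "card J + 2 = card I"
      unfolding J_def using \<open>finite I\<close> card_mono[of I "{(p, q), (p', q')}"]
      by (subst card_Diff_subset) auto
    have Sm: "S i \<in> lmeasurable" "measure lebesgue (S i) = m" for i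
      using Km by (auto simp: S_def m_def case_prod_beta measurable_translation measure_translation)
    have Vm: "V \<in> lmeasurable" "measure lebesgue V < 2 * m"
      using eU by (auto simp: V_def measurable_translation measure_translation)
    have "S (p, q) \<subseteq> V"
      using eU(1,4) by (auto simp: S_def V_def)
    moreover have "S (p', q') \<subseteq> V"
    proof
      fix y assume "y \<in> S (p', q')"
      then obtain x where x: "x \<in> K" "y = \<alpha> * p' + \<beta> * q' + x" by (auto simp: S_def)
      have "y - (\<alpha> * p + \<beta> * q) \<in> U"
      proof (rule eU(4)[OF x(1)])
        have "x - (y - (\<alpha> * p + \<beta> * q)) = \<alpha> * (p - p') + \<beta> * (q - q')"
          using x(2) by (simp add: algebra_simps)
        then show "\<bar>x - (y - (\<alpha> * p + \<beta> * q))\<bar> < \<epsilon>" using close by simp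
      qed
      then show "y \<in> V" by (force simp: V_def)
    qed
    ultimately have "(\<Union>i\<in>I. S i) \<subseteq> (\<Union>i\<in>J. S i) \<union> V"
      by (auto simp: J_def)
    moreover have "(\<lambda>x. 4 ^ n * x) ` K \<subseteq> (\<Union>i\<in>I. S i)"
      using slice_scaled[of n \<alpha> \<beta>] by (simp add: I_def S_def K_def case_prod_beta)
    ultimately have sub: "(\<lambda>x. 4 ^ n * x) ` K \<subseteq> (\<Union>i\<in>J. S i) \<union> V" by blast
    have Jm: "(\<Union>i\<in>J. S i) \<in> lmeasurable"
      using Sm \<open>finite I\<close> by (intro fmeasurable.finite_UN) (auto simp: J_def)
    have "4 ^ n * m = measure lebesgue ((\<lambda>x. 4 ^ n * x) ` K)"
      using measure_lebesgue_affine[of "4 ^ n" 0 K] by (simp add: m_def)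
    also have "\<dots> \<le> measure lebesgue ((\<Union>i\<in>J. S i) \<union> V)"
    proof (rule measure_mono_fmeasurable[OF sub])
      show "(\<lambda>x. 4 ^ n * x) ` K \<in> sets lebesgue"
        using compact_scaling[OF compact_slice, of "4 ^ n" \<alpha> \<beta>]
        by (intro fmeasurableD lmeasurable_compact) (simp add: K_def)
      show "(\<Union>i\<in>J. S i) \<union> V \<in> lmeasurable" using Jm Vm(1) by (rule fmeasurable.Un)
    qed
    also have "\<dots> \<le> measure lebesgue (\<Union>i\<in>J. S i) + measure lebesgue V"
      using Jm Vm by (intro measure_Un_le) (auto simp: fmeasurableD)
    also have "measure lebesgue (\<Union>i\<in>J. S i) \<le> (\<Sum>i\<in>J. measure lebesgue (S i))"
      using Sm \<open>finite I\<close> by (intro measure_UNION_le) (auto simp: J_def fmeasurableD)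
    also have "\<dots> = real (card J) * m" by (simp add: Sm)
    finally have "4 ^ n * m < (real (card J) + 2) * m"
      using Vm(2) by (simp add: algebra_simps)
    also have "\<dots> = real (card I) * m" using cJ by (metis of_nat_add of_nat_numeral)
    also have "\<dots> \<le> 4 ^ n * m"
      using cI \<open>0 < m\<close> by (intro mult_right_mono) (auto simp flip: of_nat_le_iff)
    finally show False by simp
  qed
  then show ?thesis using eU(1) by blast
qed

section \<open>Almost every height has close pairs\<close>

text \<open>The greedy step of the next lemma: the points \<open>0\<close>, \<open>\<alpha>\<close>, \<open>-\<alpha>\<close>, \<open>\<alpha> + \<beta>\<close>, \<open>-(\<alpha> + \<beta>)\<close> have
  gaps of at most 2 and reach up to \<open>\<plusminus>3\<close>, so one of them moves a number from \<open>[-4, 4]\<close> into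
  \<open>[-1, 1]\<close>. The second bound keeps the slope of the combination under control.\<close>

lemma bounded_digit_correction:
  fixes \<alpha> \<beta> x :: real
  assumes "\<alpha> + \<beta> = 3" "1 \<le> \<alpha>" "\<alpha> \<le> 2" "\<bar>x\<bar> \<le> 4"
  shows "\<exists>e\<in>{0,1}. \<exists>e'\<in>{0,1}. \<exists>f\<in>{0,1}. \<exists>f'\<in>{0,1}.
    \<bar>x + \<alpha> * (e - e') + \<beta> * (f - f')\<bar> \<le> 1 \<and> \<bar>(e - e') - (f - f')\<bar> \<le> (1::real)"
    (is "\<exists>e\<in>?D. \<exists>e'\<in>?D. \<exists>f\<in>?D. \<exists>f'\<in>?D. ?P e e' f f'")
proof -
  have witness: ?thesis if "?P e e' f f'" "e \<in> ?D" "e' \<in> ?D" "f \<in> ?D" "f' \<in> ?D" for e e' f f'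
    by (rule bexI[of _ e], rule bexI[of _ e'], rule bexI[of _ f], rule bexI[of _ f']) (fact that)+
  consider "\<bar>x\<bar> \<le> 1" | "\<bar>x + \<alpha>\<bar> \<le> 1" | "\<bar>x - \<alpha>\<bar> \<le> 1" | "\<bar>x + (\<alpha> + \<beta>)\<bar> \<le> 1" | "\<bar>x - (\<alpha> + \<beta>)\<bar> \<le> 1"
    using assms by argo
  then show ?thesis
  proof cases
    case 1
    then show ?thesis by (intro witness[of 0 0 0 0]) simp_all
  next
    case 2
    then show ?thesis by (intro witness[of 1 0 0 0]) simp_all
  next
    case 3
    then show ?thesis by (intro witness[of 0 1 0 0]) simp_all
  next
    case 4
    then show ?thesis by (intro witness[of 1 0 1 0]) (simp_all add: add.assoc)
  next
    case 5
    then show ?thesis by (intro witness[of 0 1 0 1]) (simp_all add: diff_diff_eq)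
  qed
qed

text \<open>As a function of \<open>t\<close> the combination has slope \<open>(p - p') - (q - q')\<close>. The construction starts from
  \<open>p - p' = 1\<close> and \<open>q - q' = -1\<close>, which gives the value \<open>2 t - 1\<close> and the slope 2. Appending one
  digit to each number multiplies value and slope by 4 and adds a correction; the digits are
  chosen to bring the value back into \<open>[-1, 1]\<close>. The errors of the slope add up to at most
  \<open>1 + 4 + \<dots> + 4 ^ (n - 1) = (4 ^ n - 1) / 3\<close>.\<close>

lemma steep_bounded_combination:
  fixes t :: real
  assumes "0 \<le> t" "t \<le> 1"
  shows "\<exists>p\<in>digit_sums (Suc n). \<exists>q\<in>digit_sums (Suc n). \<exists>p'\<in>digit_sums (Suc n). \<exists>q'\<in>digit_sums (Suc n).
    \<bar>(1 + t) * (p - p') + (2 - t) * (q - q')\<bar> \<le> 1 \<and>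
    \<bar>(p - p') - (q - q') - 2 * 4 ^ n\<bar> \<le> (4 ^ n - 1) / 3"
proof (induction n)
  case 0
  show ?case
    using assms by (intro bexI[of _ 1] bexI[of _ 0]) (auto simp: abs_le_iff)
next
  case (Suc n)
  then obtain p q p' q' where pq:
      "p \<in> digit_sums (Suc n)" "q \<in> digit_sums (Suc n)"
      "p' \<in> digit_sums (Suc n)" "q' \<in> digit_sums (Suc n)"
    and r: "\<bar>(1 + t) * (p - p') + (2 - t) * (q - q')\<bar> \<le> 1"
    and w: "\<bar>(p - p') - (q - q') - 2 * 4 ^ n\<bar> \<le> (4 ^ n - 1) / 3" by blast
  define x where "x = 4 * ((1 + t) * (p - p') + (2 - t) * (q - q'))"
  have "\<bar>x\<bar> \<le> 4" using r by (simp add: x_def abs_mult)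
  then have "\<exists>e\<in>{0,1}. \<exists>e'\<in>{0,1}. \<exists>f\<in>{0,1}. \<exists>f'\<in>{0,1}.
      \<bar>x + (1 + t) * (e - e') + (2 - t) * (f - f')\<bar> \<le> 1 \<and> \<bar>(e - e') - (f - f')\<bar> \<le> 1"
    using assms by (intro bounded_digit_correction) simp_all
  then obtain e e' f f' :: real where ef:
      "e \<in> {0,1}" "e' \<in> {0,1}" "f \<in> {0,1}" "f' \<in> {0,1}"
    and r': "\<bar>x + (1 + t) * (e - e') + (2 - t) * (f - f')\<bar> \<le> 1"
    and w': "\<bar>(e - e') - (f - f')\<bar> \<le> 1"
    by (elim bexE conjE) (rule that)
  have "\<bar>(1 + t) * ((4 * p + e) - (4 * p' + e')) + (2 - t) * ((4 * q + f) - (4 * q' + f'))\<bar> \<le> 1"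
    using r' by (simp add: x_def algebra_simps)
  moreover
  \<comment> \<open>The power is generalised to a variable to make the claim linear.\<close>
  have step: "\<bar>((4 * p + e) - (4 * p' + e')) - ((4 * q + f) - (4 * q' + f')) - 2 * (4 * c)\<bar>
      \<le> (4 * c - 1) / 3" if "\<bar>(p - p') - (q - q') - 2 * c\<bar> \<le> (c - 1) / 3" for c :: real
    using that w' by argo
  note step[OF w, folded power_Suc]
  ultimately show ?case
    by (intro bexI[of _ "4 * p + e"] bexI[of _ "4 * q + f"] bexI[of _ "4 * p' + e'"]
          bexI[of _ "4 * q' + f'"] conjI digit_sums_SucI pq ef)
qed

definition bad_heights :: "real \<Rightarrow> real set" where
  "bad_heights \<epsilon> = {t. separated \<epsilon> (1 + t) (2 - t)}"

lemma closed_bad_heights: "closed (bad_heights \<epsilon>)"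
proof -
  have "bad_heights \<epsilon> = (\<Inter>n. \<Inter>p\<in>digit_sums n. \<Inter>q\<in>digit_sums n. \<Inter>p'\<in>digit_sums n. \<Inter>q'\<in>digit_sums n.
      {t. (p, q) \<noteq> (p', q') \<longrightarrow> \<epsilon> \<le> \<bar>(1 + t) * (p - p') + (2 - t) * (q - q')\<bar>})"
    by (auto simp: bad_heights_def separated_def)
  moreover have "closed {t. (p, q) \<noteq> (p', q') \<longrightarrow> \<epsilon> \<le> \<bar>(1 + t) * (p - p') + (2 - t) * (q - q')\<bar>}"
    for p q p' q' :: real
    by (cases "(p, q) = (p', q')") (auto intro!: closed_Collect_le continuous_intros)
  ultimately show ?thesis by (simp only:) (intro closed_INT ballI)
qed

text \<open>With \<open>L = b - a\<close>, the level \<open>n\<close> is the least one at which the affine function through the midpoint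
  (slope at least \<open>4 ^ n\<close>) is sure to vanish within \<open>L / 4\<close> of it. Minimality bounds the slope by \<open>48 / L\<close>, so around the zero
  \<open>z\<close> its absolute value stays below \<open>\<epsilon>\<close> up to the radius \<open>\<rho> = \<epsilon> L / 48\<close>.\<close>

lemma bad_heights_gap:
  assumes \<epsilon>: "0 < \<epsilon>" "\<epsilon> \<le> 1" and ab: "0 \<le> a" "a < b" "b \<le> 1"
  shows "\<exists>c d. a \<le> c \<and> c \<le> d \<and> d \<le> b \<and> \<epsilon> / 24 * (b - a) \<le> d - c \<and> bad_heights \<epsilon> \<inter> {c..d} = {}"
proof -
  define L where "L = b - a"
  have L: "0 < L" "L \<le> 1" using ab by (auto simp: L_def)
  define n where "n = (LEAST n. 4 / L \<le> 4 ^ n)"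
  have "\<exists>n. 4 / L \<le> 4 ^ n"
    using real_arch_pow[of 4 "4 / L"] by (auto intro: less_imp_le)
  then have n1: "4 / L \<le> 4 ^ n"
    unfolding n_def by (rule LeastI_ex)
  have "n \<noteq> 0"
  proof
    assume "n = 0"
    then show False using n1 L by (simp add: field_simps)
  qed
  then obtain k where k: "n = Suc k" by (cases n) auto
  have "\<not> 4 / L \<le> 4 ^ k"
    using not_less_Least[of k "\<lambda>n. 4 / L \<le> 4 ^ n"] k by (simp add: n_def)
  then have n2: "4 ^ n < 16 / L" using k by (simp add: field_simps)
  define t0 where "t0 = (a + b) / 2"
  have "0 \<le> t0" "t0 \<le> 1" using ab by (auto simp: t0_def)
  then obtain p q p' q' where pq:
      "p \<in> digit_sums (Suc n)" "q \<in> digit_sums (Suc n)"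
      "p' \<in> digit_sums (Suc n)" "q' \<in> digit_sums (Suc n)"
    and r: "\<bar>(1 + t0) * (p - p') + (2 - t0) * (q - q')\<bar> \<le> 1"
    and w: "\<bar>(p - p') - (q - q') - 2 * 4 ^ n\<bar> \<le> (4 ^ n - 1) / 3"
    using steep_bounded_combination[of t0 n] by blast
  \<comment> \<open>Slope and midpoint value of the affine function.\<close>
  define w0 where "w0 = (p - p') - (q - q')"
  define r0 where "r0 = (1 + t0) * (p - p') + (2 - t0) * (q - q')"
  have lin: "(1 + t) * (p - p') + (2 - t) * (q - q') = r0 + w0 * (t - t0)" for t
    by (simp add: r0_def w0_def algebra_simps)
  have "4 ^ n \<le> w0" "w0 \<le> 3 * 4 ^ n"
    using w by (auto simp: w0_def abs_le_iff)
       (smt (verit) one_le_power field_sum_of_halves)+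
  then have w0: "4 / L \<le> w0" "w0 < 48 / L" using n1 n2 by auto
  then have "0 < w0" using L by (smt (verit) divide_pos_pos)
  define z where "z = t0 - r0 / w0"
  have "\<bar>r0 / w0\<bar> \<le> 1 / w0"
    using r \<open>0 < w0\<close> by (simp add: r0_def field_simps abs_divide)
  also have "\<dots> \<le> L / 4"
    using w0(1) L \<open>0 < w0\<close> by (simp add: field_simps)
  finally have z: "\<bar>z - t0\<bar> \<le> L / 4" by (simp add: z_def)
  define \<rho> where "\<rho> = \<epsilon> * L / 48"
  have \<rho>: "0 < \<rho>" "\<rho> \<le> L / 48"
    using \<epsilon> L by (auto simp: \<rho>_def mult_le_cancel_right1)
  have ne: "(p, q) \<noteq> (p', q')" using \<open>0 < w0\<close> by (auto simp: w0_def)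
  have "t \<notin> bad_heights \<epsilon>" if "t \<in> {z - \<rho>..z + \<rho>}" for t
  proof -
    have "r0 + w0 * (t - t0) = w0 * (t - z)"
      using \<open>0 < w0\<close> by (simp add: z_def field_simps)
    then have "\<bar>r0 + w0 * (t - t0)\<bar> = w0 * \<bar>t - z\<bar>"
      using \<open>0 < w0\<close> by (simp add: abs_mult)
    also have "\<dots> \<le> w0 * \<rho>"
      using that \<open>0 < w0\<close> by (intro mult_left_mono) (auto simp: abs_le_iff)
    also have "\<dots> < 48 / L * \<rho>"
      using w0 \<rho> by (intro mult_strict_right_mono) auto
    also have "\<dots> = \<epsilon>" using L by (simp add: \<rho>_def)
    finally have "\<not> \<epsilon> \<le> \<bar>(1 + t) * (p - p') + (2 - t) * (q - q')\<bar>" by (simp add: lin)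
    then show ?thesis using pq ne unfolding bad_heights_def separated_def by blast
  qed
  then have "bad_heights \<epsilon> \<inter> {z - \<rho>..z + \<rho>} = {}" by blast
  moreover have "a \<le> z - \<rho>" "z + \<rho> \<le> b"
    using abs_le_D1[OF z] abs_le_D2[OF z] \<rho> L(1) by (auto simp: t0_def L_def field_simps)
  moreover have "\<epsilon> / 24 * (b - a) \<le> (z + \<rho>) - (z - \<rho>)" by (simp add: \<rho>_def L_def)
  ultimately show ?thesis using \<rho>(1)
    by (intro exI[of _ "z - \<rho>"] exI[of _ "z + \<rho>"] conjI) (assumption | simp)+
qed

lemma bad_heights_null:
  assumes "0 < \<epsilon>" "\<epsilon> \<le> 1"
  shows "bad_heights \<epsilon> \<inter> {0..1} \<in> null_sets lborel"
proof -
  have "emeasure lborel (bad_heights \<epsilon> \<inter> {0..1}) = 0"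
    using porous_imp_null[of "bad_heights \<epsilon>" "\<epsilon> / 24" 0 1] closed_bad_heights
      bad_heights_gap[OF assms] assms by auto
  then show ?thesis using closed_bad_heights by (auto simp: null_sets_def)
qed

lemma AE_slice_null:
  "AE t in lborel. t \<in> {0..1} \<longrightarrow> emeasure lborel (slice (1 + t) (2 - t)) = 0"
proof (rule AE_I')
  show "(\<Union>k. bad_heights (1 / real (Suc k)) \<inter> {0..1}) \<in> null_sets lborel"
    by (rule null_sets_UN) (simp add: bad_heights_null)
  show "{t \<in> space lborel. \<not> (t \<in> {0..1} \<longrightarrow> emeasure lborel (slice (1 + t) (2 - t)) = 0)}
      \<subseteq> (\<Union>k. bad_heights (1 / real (Suc k)) \<inter> {0..1})"
  proof
    fix t assume "t \<in> {t \<in> space lborel. \<not> (t \<in> {0..1} \<longrightarrow> emeasure lborel (slice (1 + t) (2 - t)) = 0)}"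
    then have t: "t \<in> {0..1}" "emeasure lborel (slice (1 + t) (2 - t)) \<noteq> 0" by auto
    have "slice (1 + t) (2 - t) \<in> lmeasurable"
      by (rule lmeasurable_compact[OF compact_slice])
    then have "measure lebesgue (slice (1 + t) (2 - t)) \<noteq> 0"
      using t(2) compact_slice[of "1 + t" "2 - t"] emeasure_eq_measure2[of "slice (1 + t) (2 - t)" lebesgue]
      by (simp add: compact_imp_closed emeasure_completion)
    then obtain \<epsilon> where \<epsilon>: "0 < \<epsilon>" "separated \<epsilon> (1 + t) (2 - t)"
      using slice_positive_imp_separated by blast
    obtain k where "1 / real (Suc k) < \<epsilon>" using nat_approx_posE[OF \<epsilon>(1)] .
    then have "t \<in> bad_heights (1 / real (Suc k))"
      using \<epsilon>(2) separated_mono by (auto simp: bad_heights_def less_imp_le)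
    then show "t \<in> (\<Union>k. bad_heights (1 / real (Suc k)) \<inter> {0..1})" using t(1) by blast
  qed
qed

section \<open>The trapezoid\<close>

definition trapezoid_piece :: "(real \<times> real) set" where
  "trapezoid_piece = (\<Union>a\<in>cantor4. \<Union>b\<in>cantor4. closed_segment (a + 2 * b, 0) (2 * a + b, 1))"

text \<open>The weights \<open>1 + t\<close> and \<open>2 - t\<close> lie in \<open>[1, 2]\<close> and add up to 3, which is what makes the greedy
  choice of digits above possible at every height.\<close>

lemma segment_eq_image:
  "closed_segment (a + 2 * b, 0) (2 * a + b, 1) = (\<lambda>t. ((1 + t) * a + (2 - t) * b, t)) ` {0..1::real}"
proof -
  have "(1 - t) * (a + 2 * b) + t * (2 * a + b) = (1 + t) * a + (2 - t) * b" for t :: real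
    by (simp add: algebra_simps)
  then show ?thesis by (simp only: closed_segment_X0_X1 image_def) blast
qed

lemma trapezoid_piece_eq_image:
  "trapezoid_piece =
    (\<lambda>(a, b, t). ((1 + t) * a + (2 - t) * b, t)) ` (cantor4 \<times> cantor4 \<times> {0..1})"
proof -
  have "(\<Union>a\<in>A. \<Union>b\<in>B. f a b ` I) = (\<lambda>(a, b, t). f a b t) ` (A \<times> B \<times> I)"
    for f :: "real \<Rightarrow> real \<Rightarrow> real \<Rightarrow> real \<times> real" and A B I
    by force
  then show ?thesis unfolding trapezoid_piece_def segment_eq_image .
qed

lemma compact_trapezoid_piece: "compact trapezoid_piece"
  unfolding trapezoid_piece_eq_image
  by (intro compact_continuous_image compact_Times compact_cantor4)
     (auto intro!: continuous_intros simp: case_prod_beta)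

lemma trapezoid_piece_slice:
  "(\<lambda>x. (x, t)) -` trapezoid_piece = (if t \<in> {0..1} then slice (1 + t) (2 - t) else {})"
proof -
  have "(\<lambda>x. (x, t)) -` ((\<lambda>(a, b, t). (g t a b, t)) ` (A \<times> A \<times> I)) =
      (if t \<in> I then (\<lambda>(a, b). g t a b) ` (A \<times> A) else {})"
    for g :: "real \<Rightarrow> real \<Rightarrow> real \<Rightarrow> real" and A I
    by force
  from this[of "\<lambda>t a b. (1 + t) * a + (2 - t) * b"] show ?thesis
    unfolding trapezoid_piece_eq_image slice_def .
qed

lemma negligible_trapezoid_piece: "negligible trapezoid_piece"
proof -
  have meas: "trapezoid_piece \<in> sets lborel"
    using compact_trapezoid_piece by (simp add: compact_imp_closed)
  then have "trapezoid_piece \<in> sets (lborel \<Otimes>\<^sub>M lborel)" by (simp only: lborel_prod)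
  then have "emeasure lborel trapezoid_piece
      = (\<integral>\<^sup>+t. emeasure lborel ((\<lambda>x. (x, t)) -` trapezoid_piece) \<partial>lborel)"
    unfolding lborel_prod[symmetric] by (rule lborel_pair.emeasure_pair_measure_alt2)
  also have "\<dots> = (\<integral>\<^sup>+(t::real). 0 \<partial>lborel)"
    by (rule nn_integral_cong_AE) (use AE_slice_null in \<open>auto simp: trapezoid_piece_slice\<close>)
  finally have "trapezoid_piece \<in> null_sets lborel" using meas by (auto simp: null_sets_def)
  then show ?thesis by (simp add: negligible_iff_null_sets null_sets_completionI)
qed

theorem theorem3:
  "\<exists>T :: (real \<times> real) set.
     unrestricted_trapezoid T \<and>
     line_coord (T \<inter> X0) \<in> sets lebesgue \<and>
     line_coord (T \<inter> X1) \<in> sets lebesgue \<and>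
     T \<in> sets lebesgue \<and>
     emeasure lebesgue (line_coord (T \<inter> X0)) = \<infinity> \<and>
     emeasure lebesgue (line_coord (T \<inter> X1)) = \<infinity> \<and>
     emeasure lebesgue T = 0"
proof -
  define L where "L = {closed_segment (real_of_int k + (a + 2 * b), 0::real) (real_of_int k + (2 * a + b), 1) |
      k a b. a \<in> cantor4 \<and> b \<in> cantor4}"
  define T where "T = \<Union>L"
  have trap: "unrestricted_trapezoid T"
    unfolding unrestricted_trapezoid_def T_def
    by (rule exI[of _ L]) (auto simp: L_def X0_def X1_def)
  have "T = (\<Union>k::int. (+) (of_int k, 0) ` trapezoid_piece)"
    by (auto simp: T_def L_def trapezoid_piece_def image_UN closed_segment_translation[symmetric])
  then have neg: "negligible T"
    using negligible_trapezoid_piece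
    by (auto intro!: negligible_countable_Union negligible_translation)
  have digits: "\<exists>k::int. \<exists>a\<in>cantor4. \<exists>b\<in>cantor4. x = of_int k + (a + 2 * b)" for x
  proof -
    obtain a b where "a \<in> cantor4" "b \<in> cantor4" "frac x = a + 2 * b"
      using unit_interval_cantor4[of "frac x"] by (auto simp: frac_lt_1 less_imp_le)
    moreover from this have "x = of_int \<lfloor>x\<rfloor> + (a + 2 * b)" by (simp add: frac_def)
    ultimately show ?thesis by blast
  qed
  have X0: "line_coord (T \<inter> X0) = UNIV"
  proof -
    have "x \<in> line_coord (T \<inter> X0)" for x
    proof -
      obtain k :: int and a b where k: "a \<in> cantor4" "b \<in> cantor4" "x = of_int k + (a + 2 * b)"
        using digits by blast
      then have "(x, 0) \<in> T"
        unfolding T_def L_def by (blast intro: ends_in_segment)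
      then show ?thesis by (force simp: line_coord_def X0_def)
    qed
    then show ?thesis by blast
  qed
  have X1: "line_coord (T \<inter> X1) = UNIV"
  proof -
    have "x \<in> line_coord (T \<inter> X1)" for x
    proof -
      \<comment> \<open>The same representation with the roles of the two summands exchanged.\<close>
      obtain k :: int and a b where k: "a \<in> cantor4" "b \<in> cantor4" "x = of_int k + (2 * a + b)"
        using digits[of x] by (metis add.commute)
      then have "(x, 1) \<in> T"
        unfolding T_def L_def by (blast intro: ends_in_segment)
      then show ?thesis by (force simp: line_coord_def X1_def)
    qed
    then show ?thesis by blast
  qed
  show ?thesis
    using trap neg X0 X1
    by (intro exI[of _ T]) (auto simp: negligible_iff_null_sets null_sets_def emeasure_lborel_UNIV)
qed

end
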